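(* Let $P\subset\mathbb{R}^d$ be a full-dimensional convex polytope. Suppose that for every face $\sigma$ of $P$ at least one of the following holds: (a) $\sigma$, viewed as a polytope, has at least as many facets as vertices, i.e. the number of faces of $P$ of dimension $\dim\sigma-1$ contained in $\sigma$ is at least the number of vertices of $P$ contained in $\sigma$; or (b) the dual face $\sigma^*$ has at least as many facets as vertices, i.e. the number of faces of $P$ of dimension $\dim\sigma+1$ containing $\sigma$ is at least the number of facets of $P$ containing $\sigma$. Then $P$ has a vertex-facet assignment.
   Context: A convex polytope $P\subset\mathbb{R}^d$ is the convex hull of finitely many points; it is full-dimensional if its affine hull is $\mathbb{R}^d$. The dual face $\sigma^*$ of a face $\sigma$ of $P$ is the face of the dual polytope $P^*$ corresponding to $\sigma$: its face lattice is the interval of faces $\tau$ of $P$ with $\sigma\subseteq\tau\subseteq P$, with reversed order; thus its vertices correspond to facets of $P$ containing $\sigma$ and its facets correspond to faces of $P$ of dimension $\dim\sigma+1$ containing $\sigma$. A vertex-facet assignment of $P$ is a set $M$ of pairs $(v,F)$ with $v$ a vertex of $P$, $F$ a facet of $P$, and $v\notin F$, such that each vertex and each facet occurs in at most one pair of $M$, and such that either every vertex of $P$ occurs in some pair of $M$ or every facet of $P$ occurs in some pair of $M$ (or both). *)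

theory Defs
  imports "HOL-Analysis.Polytope"
begin

definition vertex_facet_assignment ::
    "'a::euclidean_space set \<Rightarrow> ('a \<times> 'a set) set \<Rightarrow> bool" where
  "vertex_facet_assignment P M \<longleftrightarrow>
     (\<forall>(v, F) \<in> M. v extreme_point_of P \<and> F facet_of P \<and> v \<notin> F) \<and>
     (\<forall>v F G. (v, F) \<in> M \<and> (v, G) \<in> M \<longrightarrow> F = G) \<and>
     (\<forall>v w F. (v, F) \<in> M \<and> (w, F) \<in> M \<longrightarrow> v = w) \<and>
     ((\<forall>v. v extreme_point_of P \<longrightarrow> (\<exists>F. (v, F) \<in> M)) \<or>
      (\<forall>F. F facet_of P \<longrightarrow> (\<exists>v. (v, F) \<in> M)))"

end

theory Submission
  imports Defs
begin

text \<open>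
  By Hall's theorem, a matching of the vertices into the facets not containing them exists unless
  some set \<open>S\<close> of vertices is too large; enlarging \<open>S\<close> to the vertex set of the
  smallest face \<open>\<sigma>\<close> containing it does not change its neighbours, so only faces have
  to be tested, and likewise for facets. Both Hall conditions ask that the number of vertices in
  \<open>\<sigma>\<close> plus the number of facets containing \<open>\<sigma>\<close> be at most the
  size of the larger side. A facet of \<open>\<sigma>\<close> is cut out of \<open>\<sigma>\<close> by
  a facet of \<open>P\<close> that does not contain \<open>\<sigma>\<close>, so (a) bounds this sum by
  the number of facets. Dually, every face one dimension above \<open>\<sigma>\<close> has a vertex of
  its own outside \<open>\<sigma>\<close>, so (b) bounds the sum by the number of vertices.
\<close>

section \<open>Hall's marriage theorem for finite families of finite sets\<close>

text \<open>Induction on \<open>card I\<close>. A tight nonempty proper subfamily \<open>J\<close>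
  is matched inside its union and the remaining indices outside it. Without one, every nonempty
  proper subfamily has an element to spare, so one index may take any of its elements.\<close>

lemma hall_marriage:
  assumes "finite I" "\<And>i. i \<in> I \<Longrightarrow> finite (A i)"
    and "\<And>J. J \<subseteq> I \<Longrightarrow> card J \<le> card (\<Union>i\<in>J. A i)"
  shows "\<exists>f. inj_on f I \<and> (\<forall>i\<in>I. f i \<in> A i)"
  using assms
proof (induction "card I" arbitrary: I A rule: less_induct)
  case less
  show ?case
  proof (cases "\<exists>J. J \<noteq> {} \<and> J \<subset> I \<and> card J = card (\<Union>i\<in>J. A i)")
    case True
    then obtain J where J: "J \<noteq> {}" "J \<subset> I" "card J = card (\<Union>i\<in>J. A i)" by blast
    define U where "U = (\<Union>i\<in>J. A i)"
    have fin: "finite J" "finite (I - J)" "finite U"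
      using J less.prems finite_subset[of J I] by (auto simp: U_def)
    have "\<exists>f. inj_on f J \<and> (\<forall>i\<in>J. f i \<in> A i)"
    proof (rule less.hyps)
      show "card J < card I"
        using J(2) less.prems(1) by (intro psubset_card_mono)
      show "card K \<le> card (\<Union>i\<in>K. A i)" if "K \<subseteq> J" for K
        using that J(2) by (intro less.prems) auto
    qed (use fin(1) J(2) less.prems(2) in auto)
    then obtain f where f: "inj_on f J" "\<forall>i\<in>J. f i \<in> A i" by blast
    \<comment> \<open>Hall's condition survives the removal of \<open>U\<close>: apply it to
      \<open>K \<union> J\<close> and cancel \<open>card J = card U\<close>.\<close>
    have "card K \<le> card (\<Union>i\<in>K. A i - U)" if "K \<subseteq> I - J" for K
    proof -
      have K: "finite K" "K \<inter> J = {}" "K \<union> J \<subseteq> I"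
        using that J finite_subset[OF that fin(2)] by auto
      then have "finite (\<Union>i\<in>K. A i - U)"
        using less.prems(2) by (intro finite_UN_I) auto
      have "card K + card J = card (K \<union> J)"
        using K fin by (simp add: card_Un_disjoint)
      also have "\<dots> \<le> card (\<Union>i\<in>K \<union> J. A i)"
        using K by (intro less.prems)
      also have "(\<Union>i\<in>K \<union> J. A i) = (\<Union>i\<in>K. A i - U) \<union> U"
        by (auto simp: U_def)
      also have "card \<dots> = card (\<Union>i\<in>K. A i - U) + card U"
        using \<open>finite (\<Union>i\<in>K. A i - U)\<close> fin by (intro card_Un_disjoint) auto
      finally show ?thesis
        using J by (simp add: U_def)
    qed
    moreover have "card (I - J) < card I"
      using J less.prems(1) by (intro psubset_card_mono) auto
    ultimately obtain g where g: "inj_on g (I - J)" "\<forall>i\<in>I - J. g i \<in> A i - U"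
      using less.hyps[of "I - J" "\<lambda>i. A i - U"] less.prems(2) fin by auto
    define h where "h i = (if i \<in> J then f i else g i)" for i
    have "inj_on h J" "inj_on h (I - J)"
      using f(1) g(1) by (simp_all add: h_def inj_on_def)
    moreover have "h ` J \<subseteq> U" "h ` (I - J) \<inter> U = {}"
      using f(2) g(2) by (auto simp: h_def U_def)
    ultimately have "inj_on h (J \<union> (I - J))"
      unfolding inj_on_Un by blast
    then have "inj_on h I"
      using J(2) by (simp add: Un_absorb1 psubset_imp_subset)
    moreover have "\<forall>i\<in>I. h i \<in> A i"
      using f g by (auto simp: h_def)
    ultimately show ?thesis by blast
  next
    case no_tight: False
    show ?thesis
    proof (cases "I = {}")
      case False
      then obtain i where i: "i \<in> I" by blast
      then have "A i \<noteq> {}"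
        using less.prems(3)[of "{i}"] by auto
      then obtain a where a: "a \<in> A i" by blast
      \<comment> \<open>Deleting \<open>a\<close> costs at most one element, which the strict
        inequality for nonempty proper \<open>K\<close> absorbs.\<close>
      have "card K \<le> card (\<Union>j\<in>K. A j - {a})" if K: "K \<subseteq> I - {i}" for K
      proof (cases "K = {}")
        case False
        have "K \<subset> I"
          using K i by blast
        then have "card K < card (\<Union>j\<in>K. A j)"
          using False no_tight less.prems(3)[of K] by (metis le_neq_implies_less psubset_imp_subset)
        moreover have "(\<Union>j\<in>K. A j - {a}) = (\<Union>j\<in>K. A j) - {a}"
          by blast
        ultimately show ?thesis
          by (auto simp: card_Diff_singleton_if)
      qed simp
      moreover have "card (I - {i}) < card I"
        using i less.prems(1) by (rule card_Diff1_less[rotated])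
      ultimately obtain g where g: "inj_on g (I - {i})" "\<forall>j\<in>I - {i}. g j \<in> A j - {a}"
        using less.hyps[of "I - {i}" "\<lambda>j. A j - {a}"] less.prems by auto
      have "inj_on (g(i := a)) I"
      proof -
        have "a \<notin> g ` (I - {i})"
          using g(2) by blast
        then have "inj_on (g(i := a)) (insert i (I - {i}))"
          unfolding inj_on_insert using inj_on_fun_updI[OF g(1)] by auto
        then show ?thesis
          using i by (simp add: insert_absorb)
      qed
      moreover have "\<forall>j\<in>I. (g(i := a)) j \<in> A j"
        using g a by auto
      ultimately show ?thesis by blast
    qed simp
  qed
qed

section \<open>Vertices and facets that tell faces apart\<close>

text \<open>By Krein-Milman a face is the hull of its own vertices, which are vertices of
  \<open>P\<close>; if all of them lay in the convex set \<open>\<sigma>\<close>, so would the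
  face.\<close>

lemma ex_extreme_point_in_face_diff:
  fixes P :: "'a::euclidean_space set"
  assumes "polytope P" "\<tau> face_of P" "convex \<sigma>" "\<not> \<tau> \<subseteq> \<sigma>"
  shows "\<exists>v. v extreme_point_of P \<and> v \<in> \<tau> \<and> v \<notin> \<sigma>"
proof (rule ccontr)
  assume "\<not> ?thesis"
  then have "{v. v extreme_point_of \<tau>} \<subseteq> \<sigma>"
    using extreme_point_of_face[OF assms(2)] by auto
  then have "convex hull {v. v extreme_point_of \<tau>} \<subseteq> \<sigma>"
    using assms(3) by (rule hull_minimal)
  moreover have "polytope \<tau>"
    using assms face_of_polytope_polytope by blast
  ultimately show False
    using assms(4) Krein_Milman_Minkowski[of \<tau>] polytope_imp_compact polytope_imp_convex by metis
qed

text \<open>A nonempty proper face is the intersection of the facets containing it, so one of these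
  fails to contain \<open>\<sigma>\<close>. The empty face matters as well, being the facet of a
  vertex; a one-point \<open>P\<close> is excluded because it has no facets in the sense of
  \<open>facet_of\<close>.\<close>

lemma ex_facet_separating_faces:
  fixes P :: "'a::euclidean_space set"
  assumes P: "polytope P" "aff_dim P \<noteq> 0"
    and \<sigma>: "\<sigma> face_of P" and \<tau>: "\<tau> face_of P" and not_sub: "\<not> \<sigma> \<subseteq> \<tau>"
  shows "\<exists>F. F facet_of P \<and> \<tau> \<subseteq> F \<and> \<not> \<sigma> \<subseteq> F"
proof -
  have nonempty: "\<exists>F. F facet_of P \<and> \<rho> \<subseteq> F \<and> \<not> \<sigma> \<subseteq> F"
    if "\<rho> face_of P" "\<rho> \<noteq> {}" "\<not> \<sigma> \<subseteq> \<rho>" for \<rho>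
  proof -
    have "\<rho> \<noteq> P"
      using that \<sigma> face_of_imp_subset by blast
    then have "\<rho> = \<Inter>{F. F facet_of P \<and> \<rho> \<subseteq> F}"
      using that P by (intro face_of_polyhedron polytope_imp_polyhedron)
    then show ?thesis
      using that(3) by blast
  qed
  show ?thesis
  proof (cases "\<tau> = {}")
    case True
    \<comment> \<open>The empty face is replaced by \<open>{w}\<close> for a vertex \<open>w\<close>
      other than some vertex \<open>v\<close> of \<open>\<sigma>\<close>, which is nonempty and
      still does not contain \<open>\<sigma>\<close>.\<close>
    obtain v where v: "v extreme_point_of P" "v \<in> \<sigma>"
      using ex_extreme_point_in_face_diff[OF P(1) \<sigma>, of \<tau>] \<tau> not_sub face_of_imp_convex by blast
    then have "v \<in> P"
      using \<sigma> face_of_imp_subset by blast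
    then have "\<not> P \<subseteq> {v}"
      using P(2) by (metis aff_dim_sing insert_absorb insert_not_empty subset_singletonD)
    then obtain w where w: "w extreme_point_of P" "w \<noteq> v"
      using ex_extreme_point_in_face_diff[OF P(1) face_of_refl, of "{v}"]
        polytope_imp_convex[OF P(1)] by auto
    then show ?thesis
      using nonempty[of "{w}"] v True by (auto simp: face_of_singleton)
  qed (use nonempty \<tau> not_sub in blast)
qed

lemma face_of_subset_eqI:
  fixes P :: "'a::euclidean_space set"
  assumes "\<rho> face_of P" "\<tau> face_of P" "\<rho> \<subseteq> \<tau>" "aff_dim \<tau> \<le> aff_dim \<rho>"
  shows "\<rho> = \<tau>"
  using assms face_of_aff_dim_lt[of \<tau> \<rho>] face_of_face[of \<tau> P \<rho>] face_of_imp_convex[of \<tau> P]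
  by fastforce

section \<open>Counting the faces just below and just above a given face\<close>

text \<open>The map \<open>F \<mapsto> \<sigma> \<inter> F\<close> on facets not containing
  \<open>\<sigma>\<close> reaches every facet of \<open>\<sigma>\<close>. It may also reach smaller
  faces, so only an inclusion in the image is claimed.\<close>

lemma card_facets_of_face_le:
  fixes P :: "'a::euclidean_space set"
  assumes P: "polytope P" "aff_dim P \<noteq> 0" and \<sigma>: "\<sigma> face_of P"
  shows "card {\<tau>. \<tau> face_of P \<and> \<tau> \<subseteq> \<sigma> \<and> aff_dim \<tau> = aff_dim \<sigma> - 1}
    \<le> card {F. F facet_of P \<and> \<not> \<sigma> \<subseteq> F}"
proof (rule surj_card_le)
  show "finite {F. F facet_of P \<and> \<not> \<sigma> \<subseteq> F}"
    using finite_polytope_facets[OF P(1)] by simp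
  show "{\<tau>. \<tau> face_of P \<and> \<tau> \<subseteq> \<sigma> \<and> aff_dim \<tau> = aff_dim \<sigma> - 1}
    \<subseteq> (\<inter>) \<sigma> ` {F. F facet_of P \<and> \<not> \<sigma> \<subseteq> F}"
  proof clarify
    fix \<tau> assume \<tau>: "\<tau> face_of P" "\<tau> \<subseteq> \<sigma>" "aff_dim \<tau> = aff_dim \<sigma> - 1"
    then have "\<not> \<sigma> \<subseteq> \<tau>" by auto
    then obtain F where F: "F facet_of P" "\<tau> \<subseteq> F" "\<not> \<sigma> \<subseteq> F"
      using ex_facet_separating_faces[OF P \<sigma> \<tau>(1)] by blast
    have face: "\<sigma> \<inter> F face_of P"
      using \<sigma> F facet_of_imp_face_of face_of_Int by blast
    then have "\<sigma> \<inter> F face_of \<sigma>"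
      using face_of_face[OF \<sigma>] by blast
    moreover have "\<sigma> \<inter> F \<noteq> \<sigma>"
      using F by blast
    \<comment> \<open>This squeezes the dimension: \<open>\<sigma> \<inter> F\<close> contains
      \<open>\<tau>\<close>, which is only one dimension below \<open>\<sigma>\<close>.\<close>
    ultimately have "aff_dim (\<sigma> \<inter> F) < aff_dim \<sigma>"
      using face_of_aff_dim_lt face_of_imp_convex \<sigma> by blast
    then have "\<tau> = \<sigma> \<inter> F"
      using face_of_subset_eqI[OF \<tau>(1) face] \<tau> F by auto
    then show "\<tau> \<in> (\<inter>) \<sigma> ` {F. F facet_of P \<and> \<not> \<sigma> \<subseteq> F}"
      using F by blast
  qed
qed

lemma card_faces_covering_face_le:
  fixes P :: "'a::euclidean_space set"
  assumes P: "polytope P" and \<sigma>: "\<sigma> face_of P"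
  shows "card {\<tau>. \<tau> face_of P \<and> \<sigma> \<subseteq> \<tau> \<and> aff_dim \<tau> = aff_dim \<sigma> + 1}
    \<le> card {v. v extreme_point_of P \<and> v \<notin> \<sigma>}"
proof -
  define T where "T = {\<tau>. \<tau> face_of P \<and> \<sigma> \<subseteq> \<tau> \<and> aff_dim \<tau> = aff_dim \<sigma> + 1}"
  have "\<exists>v. v extreme_point_of P \<and> v \<in> \<tau> \<and> v \<notin> \<sigma>" if "\<tau> \<in> T" for \<tau>
  proof (rule ex_extreme_point_in_face_diff[OF P])
    show "\<not> \<tau> \<subseteq> \<sigma>"
      using that by (auto simp: T_def dest: aff_dim_subset)
  qed (use that \<sigma> in \<open>auto simp: T_def face_of_imp_convex\<close>)
  then obtain f where f: "\<And>\<tau>. \<tau> \<in> T \<Longrightarrow> f \<tau> extreme_point_of P \<and> f \<tau> \<in> \<tau> \<and> f \<tau> \<notin> \<sigma>"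
    by metis
  have "inj_on f T"
  proof (rule inj_onI)
    fix \<tau> \<tau>' assume \<tau>: "\<tau> \<in> T" "\<tau>' \<in> T" "f \<tau> = f \<tau>'"
    have face: "\<tau> \<inter> \<tau>' face_of P"
      using \<tau> by (simp add: T_def face_of_Int)
    \<comment> \<open>The shared vertex makes the intersection a face strictly above
      \<open>\<sigma>\<close>, hence of the full dimension of \<open>\<tau>\<close> and of
      \<open>\<tau>'\<close>, and equal to both.\<close>
    have "\<sigma> \<subseteq> \<tau> \<inter> \<tau>'" "\<sigma> \<noteq> \<tau> \<inter> \<tau>'"
      using \<tau> f[of \<tau>] f[of \<tau>'] by (auto simp: T_def)
    then have "aff_dim \<sigma> < aff_dim (\<tau> \<inter> \<tau>')"
      using face_of_subset_eqI[OF \<sigma> face] by fastforce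
    then have "\<tau> \<inter> \<tau>' = \<rho>" if "\<rho> \<in> T" "\<tau> \<inter> \<tau>' \<subseteq> \<rho>" for \<rho>
      using that face_of_subset_eqI[OF face, of \<rho>] by (simp add: T_def)
    then show "\<tau> = \<tau>'"
      using \<tau> by blast
  qed
  moreover have "f ` T \<subseteq> {v. v extreme_point_of P \<and> v \<notin> \<sigma>}"
    using f by blast
  moreover have "finite {v. v extreme_point_of P \<and> v \<notin> \<sigma>}"
    using finite_polyhedron_extreme_points[OF polytope_imp_polyhedron[OF P]] by simp
  ultimately show ?thesis
    unfolding T_def[symmetric] by (rule card_inj_on_le)
qed

lemma card_Collect_split:
  assumes "finite {x. p x}"
  shows "card {x. p x} = card {x. p x \<and> q x} + card {x. p x \<and> \<not> q x}"
  using assms by (subst card_Un_disjoint[symmetric]) (auto intro: arg_cong[where f = card])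

text \<open>The first alternative bounds the sum by the number of facets, the second by the number
  of vertices. Taking \<open>max\<close> forgets which one held, so the side to be matched can be
  chosen once for all faces.\<close>

lemma vertices_plus_facets_of_face_le:
  fixes P :: "'a::euclidean_space set"
  assumes P: "polytope P" "aff_dim P \<noteq> 0" and \<sigma>: "\<sigma> face_of P"
    and ab: "card {v. v extreme_point_of P \<and> v \<in> \<sigma>}
             \<le> card {\<tau>. \<tau> face_of P \<and> \<tau> \<subseteq> \<sigma> \<and> aff_dim \<tau> = aff_dim \<sigma> - 1}
         \<or> card {F. F facet_of P \<and> \<sigma> \<subseteq> F}
             \<le> card {\<tau>. \<tau> face_of P \<and> \<sigma> \<subseteq> \<tau> \<and> aff_dim \<tau> = aff_dim \<sigma> + 1}"
  shows "card {v. v extreme_point_of P \<and> v \<in> \<sigma>} + card {F. F facet_of P \<and> \<sigma> \<subseteq> F}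
    \<le> max (card {v. v extreme_point_of P}) (card {F. F facet_of P})"
  using ab card_facets_of_face_le[OF P \<sigma>] card_faces_covering_face_le[OF P(1) \<sigma>]
    card_Collect_split[OF finite_polytope_facets[OF P(1)], of "\<lambda>F. \<sigma> \<subseteq> F"]
    card_Collect_split[OF finite_polyhedron_extreme_points[OF polytope_imp_polyhedron[OF P(1)]],
      of "\<lambda>v. v \<in> \<sigma>"]
  by linarith

section \<open>From bounds on faces to Hall's condition\<close>

lemma vertex_facet_assignment_if_vertices_le_facets:
  fixes P :: "'a::euclidean_space set"
  assumes P: "polytope P"
    and le: "card {v. v extreme_point_of P} \<le> card {F. F facet_of P}"
    and faces: "\<And>\<sigma>. \<sigma> face_of P \<Longrightarrow>
      card {v. v extreme_point_of P \<and> v \<in> \<sigma>} + card {F. F facet_of P \<and> \<sigma> \<subseteq> F}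
        \<le> card {F. F facet_of P}"
  shows "\<exists>M. vertex_facet_assignment P M"
proof -
  define V where "V = {v. v extreme_point_of P}"
  define A where "A v = {F. F facet_of P \<and> v \<notin> F}" for v
  have fin: "finite V" "finite {F. F facet_of P}"
    using P by (auto simp: V_def finite_polytope_facets
        intro: finite_polyhedron_extreme_points polytope_imp_polyhedron)
  have "card S \<le> card (\<Union>v\<in>S. A v)" if S: "S \<subseteq> V" for S
  proof -
    define T where "T = {F. F facet_of P \<and> S \<subseteq> F}"
    have UN: "(\<Union>v\<in>S. A v) = {F. F facet_of P \<and> \<not> S \<subseteq> F}"
      by (auto simp: A_def)
    show ?thesis
    proof (cases "T = {}")
      \<comment> \<open>Here \<open>\<Inter>T\<close> would be the whole space, not a face; but
        every facet is then a neighbour of \<open>S\<close>, and \<open>le\<close> suffices.\<close>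
      case True
      then have "(\<Union>v\<in>S. A v) = {F. F facet_of P}"
        unfolding UN T_def by blast
      then show ?thesis
        using le card_mono[OF fin(1) S] by (simp add: V_def)
    next
      case False
      have "\<Inter>T face_of P"
        using False by (intro face_of_Inter) (auto simp: T_def facet_of_imp_face_of)
      then have "card {v. v extreme_point_of P \<and> v \<in> \<Inter>T} + card {F. F facet_of P \<and> \<Inter>T \<subseteq> F}
          \<le> card {F. F facet_of P}"
        by (rule faces)
      \<comment> \<open>Enlarging \<open>S\<close> to the vertices of \<open>\<Inter>T\<close>
        leaves its neighbours unchanged.\<close>
      moreover have "{F. F facet_of P \<and> \<Inter>T \<subseteq> F} = {F. F facet_of P \<and> S \<subseteq> F}"
        by (auto simp: T_def)
      moreover have "card S \<le> card {v. v extreme_point_of P \<and> v \<in> \<Inter>T}"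
        using S fin by (intro card_mono) (auto simp: V_def T_def)
      ultimately show ?thesis
        using card_Collect_split[OF fin(2), of "\<lambda>F. S \<subseteq> F"] unfolding UN by simp
    qed
  qed
  then obtain f where f: "inj_on f V" "\<forall>v\<in>V. f v \<in> A v"
    using hall_marriage[of V A] fin by (auto simp: A_def)
  have "vertex_facet_assignment P ((\<lambda>v. (v, f v)) ` V)"
    using f unfolding vertex_facet_assignment_def by (auto simp: V_def A_def inj_on_def)
  then show ?thesis by blast
qed

text \<open>Facets now choose vertices. The neighbours of a nonempty family \<open>T\<close> are the
  vertices outside the face \<open>\<Inter>T\<close>, so \<open>T\<close> may be enlarged to all
  facets containing that face.\<close>

lemma vertex_facet_assignment_if_facets_le_vertices:
  fixes P :: "'a::euclidean_space set"
  assumes P: "polytope P"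
    and faces: "\<And>\<sigma>. \<sigma> face_of P \<Longrightarrow>
      card {v. v extreme_point_of P \<and> v \<in> \<sigma>} + card {F. F facet_of P \<and> \<sigma> \<subseteq> F}
        \<le> card {v. v extreme_point_of P}"
  shows "\<exists>M. vertex_facet_assignment P M"
proof -
  define \<F> where "\<F> = {F. F facet_of P}"
  define A where "A F = {v. v extreme_point_of P \<and> v \<notin> F}" for F
  have fin: "finite \<F>" "finite {v. v extreme_point_of P}"
    using P by (auto simp: \<F>_def finite_polytope_facets
        intro: finite_polyhedron_extreme_points polytope_imp_polyhedron)
  have "card T \<le> card (\<Union>F\<in>T. A F)" if T: "T \<subseteq> \<F>" for T
  proof (cases "T = {}")
    case False
    have UN: "(\<Union>F\<in>T. A F) = {v. v extreme_point_of P \<and> v \<notin> \<Inter>T}"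
      by (auto simp: A_def)
    have "\<Inter>T face_of P"
      using False T by (intro face_of_Inter) (auto simp: \<F>_def facet_of_imp_face_of)
    then have "card {v. v extreme_point_of P \<and> v \<in> \<Inter>T} + card {F. F facet_of P \<and> \<Inter>T \<subseteq> F}
        \<le> card {v. v extreme_point_of P}"
      by (rule faces)
    moreover have "card T \<le> card {F. F facet_of P \<and> \<Inter>T \<subseteq> F}"
      using T fin by (intro card_mono) (auto simp: \<F>_def)
    ultimately show ?thesis
      using card_Collect_split[OF fin(2), of "\<lambda>v. v \<in> \<Inter>T"] unfolding UN by linarith
  qed simp
  then obtain f where f: "inj_on f \<F>" "\<forall>F\<in>\<F>. f F \<in> A F"
    using hall_marriage[of \<F> A] fin by (auto simp: A_def)
  have "vertex_facet_assignment P ((\<lambda>F. (f F, F)) ` \<F>)"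
    using f unfolding vertex_facet_assignment_def by (auto simp: \<F>_def A_def inj_on_def)
  then show ?thesis by blast
qed

theorem theorem4p4:
  fixes P :: "(real ^ 'd::finite) set"
  assumes "polytope P"
    and "affine hull P = UNIV"
    and "\<And>\<sigma>. \<sigma> face_of P \<Longrightarrow>
           card {v. v extreme_point_of P \<and> v \<in> \<sigma>}
             \<le> card {\<tau>. \<tau> face_of P \<and> \<tau> \<subseteq> \<sigma> \<and> aff_dim \<tau> = aff_dim \<sigma> - 1}
         \<or> card {F. F facet_of P \<and> \<sigma> \<subseteq> F}
             \<le> card {\<tau>. \<tau> face_of P \<and> \<sigma> \<subseteq> \<tau> \<and> aff_dim \<tau> = aff_dim \<sigma> + 1}"
  shows "\<exists>M. vertex_facet_assignment P M"
proof -
  have "aff_dim P = int DIM(real ^ 'd)"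
    using assms(2) by (metis aff_dim_UNIV aff_dim_affine_hull)
  \<comment> \<open>The index type \<open>'d\<close> is nonempty, so the space has positive
    dimension.\<close>
  then have "aff_dim P \<noteq> 0"
    by simp
  note bound = vertices_plus_facets_of_face_le[OF assms(1) this _ assms(3)]
  show ?thesis
  proof (cases "card {v. v extreme_point_of P} \<le> card {F. F facet_of P}")
    case True
    then show ?thesis
      using bound by (intro vertex_facet_assignment_if_vertices_le_facets assms(1)) (auto simp: max_def)
  next
    case False
    then show ?thesis
      using bound by (intro vertex_facet_assignment_if_facets_le_vertices assms(1)) (auto simp: max_def)
  qed
qed

end
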